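(* Let $p_1<\cdots<p_n$ be primes. If $\Gamma(G),\Gamma(H)\in\mathcal{T}_{p_1\cdots p_n}$, then $\Gamma(G)\leq\Gamma(H)$ if and only if $Y(\mu)$ fits in $Y(\eta)$, where $\mu$ and $\eta$ are the threshold eigenvalues partitions of the graphs $\Gamma(G)$ and $\Gamma(H)$ respectively.
   Context: For a finite abelian group $G$ viewed as a $\mathbb{Z}$-module and $a\in G$, put $[a:G]=\{x\in\mathbb{Z} : xG\subseteq \mathbb{Z}a\}$. The graph realized by $G$ is the group-annihilator graph $\Gamma(G)$: the simple graph with vertex set $G$ in which distinct $a,b$ are adjacent if and only if $[a:G][b:G]G=\{0\}$. $\mathcal{T}_{p_1\cdots p_n}$ is the set of all graphs (up to isomorphism) realized by finite abelian $p_r$-groups of rank $1$ (cyclic groups $\mathbb{Z}/p_r^m\mathbb{Z}$, $m\geq1$), $1\le r\le n$. In $\Gamma(\mathbb{Z}/p^m\mathbb{Z})$ distinct vertices $p^i\alpha$ and $p^j\beta$ with $\alpha,\beta$ prime to $p$ and $0\le i,j\le m$ are adjacent if and only if $i+j\ge m$. Graphs $\Gamma(G),\Gamma(H)\in\mathcal{T}_{p_1\cdots p_n}$ are related by $\Gamma(G)\leq\Gamma(H)$ if and only if $\Gamma(H)$ contains a subgraph isomorphic to $\Gamma(G)$, that is, $\Gamma(G)$ can be obtained from $\Gamma(H)$ by deletion of vertices. The threshold eigenvalues partition of $\Gamma(G)$ is the sequence $\pi=(\pi_1\ge\pi_2\ge\cdots)$ of its nonzero Laplacian eigenvalues with multiplicity;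 it is the conjugate partition of the degree sequence $\pi^\bullet$ of $\Gamma(G)$ and satisfies $\pi_i=\pi_i^\bullet+1$ for $1\le i\le tr(Y(\pi))=|\{i:\pi_i\ge i\}|$. $Y(\pi)$ is the Young diagram of $\pi$ (left-justified rows, $\pi_i$ boxes in row $i$), and $Y(\mu)$ fits in $Y(\eta)$ if the diagram $Y(\mu)$ is contained in $Y(\eta)$, i.e. $\mu_i\le\eta_i$ for all $i$ (missing parts being $0$). *)

theory Defs
  imports
    "HOL-Computational_Algebra.Primes"
    "HOL-Library.Multiset"
    "HOL-Algebra.IntRing"
    "HOL-Algebra.Ideal_Product"
    "HOL-Algebra.Elementary_Groups"
    "Graph_Theory.Graph_Theory"
    "Jordan_Normal_Form.Char_Poly"
begin

text \<open>
  Abelian groups are written multiplicatively, so the integer multiple \<open>x g\<close> of a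
  \<open>\<Z>\<close>-module element \<open>g\<close> is \<open>g [^] x\<close>, and the zero submodule is \<open>{\<one>}\<close>.
\<close>

definition residual :: "('a, 'm) monoid_scheme \<Rightarrow> 'a \<Rightarrow> int set" where
  "residual G a =
     {x. (\<lambda>g. g [^]\<^bsub>G\<^esub> x) ` carrier G \<subseteq> range (\<lambda>z::int. a [^]\<^bsub>G\<^esub> z)}"

definition ideal_action :: "('a, 'm) monoid_scheme \<Rightarrow> int set \<Rightarrow> 'a set" where
  "ideal_action G I = generate G {g [^]\<^bsub>G\<^esub> x | g x. g \<in> carrier G \<and> x \<in> I}"

text \<open>
  As in \<open>Graph_Theory\<close>, a finite simple graph is a symmetric loop-free digraph without
  multiple arcs.
\<close>

definition ann_graph :: "('a, 'm) monoid_scheme \<Rightarrow> ('a, 'a \<times> 'a) pre_digraph" where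
  "ann_graph G = with_proj
     \<lparr> pverts = carrier G,
       parcs = {(a, b). a \<in> carrier G \<and> b \<in> carrier G \<and> a \<noteq> b \<and>
                  ideal_action G (ideal_prod \<Z> (residual G a) (residual G b)) = {\<one>\<^bsub>G\<^esub>}} \<rparr>"

lemma ideal_prod_int_commute: "ideal_prod \<Z> I J = ideal_prod \<Z> J I"
proof -
  have "ideal_prod \<Z> A B \<subseteq> ideal_prod \<Z> B A" for A B
  proof
    fix x assume "x \<in> ideal_prod \<Z> A B"
    then show "x \<in> ideal_prod \<Z> B A"
    proof induction
      case (prod i j)
      then show ?case
        using ideal_prod.prod[of j B i A \<Z>] by (simp add: mult.commute)
    next
      case (sum s1 s2)
      then show ?case by (rule_tac ideal_prod.sum)
    qed
  qed
  then show ?thesis by blast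
qed

lemma graph_ann_graph:
  assumes "finite (carrier G)"
  shows "graph (ann_graph G)"
proof -
  define P where "P = \<lparr> pverts = carrier G,
       parcs = {(a, b). a \<in> carrier G \<and> b \<in> carrier G \<and> a \<noteq> b \<and>
                  ideal_action G (ideal_prod \<Z> (residual G a) (residual G b)) = {\<one>\<^bsub>G\<^esub>}} \<rparr>"
  have "finite (parcs P)"
    by (rule finite_subset[of _ "carrier G \<times> carrier G"]) (auto simp: P_def assms)
  moreover have "sym (parcs P)"
    by (auto simp: P_def sym_def ideal_prod_int_commute)
  ultimately have "pair_graph P"
    by unfold_locales
       (auto simp: P_def assms arcs_ends_conv symmetric_def with_proj_def)
  then show ?thesis
    unfolding ann_graph_def P_def[symmetric] by (rule pair_graph.pair_graphD_graph)
qed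

text \<open>
  The family is closed under isomorphism, which renders ``graphs up to isomorphism''.
  The finite abelian \<open>q\<close>-groups of rank 1 are the cyclic groups \<open>\<Z>/q\<^sup>m\<Z>\<close> with \<open>m \<ge> 1\<close>.
\<close>

definition realized_graphs :: "(nat \<Rightarrow> nat) \<Rightarrow> nat \<Rightarrow> ('v, 'e) pre_digraph set" where
  "realized_graphs p n =
     {\<Gamma>. \<exists>r\<in>{1..n}. \<exists>m\<ge>1. digraph_iso (ann_graph (integer_mod_group (p r ^ m))) \<Gamma>}"

text \<open>Subgraphs are not required to be induced.\<close>

definition graph_le :: "('v, 'e) pre_digraph \<Rightarrow> ('w, 'f) pre_digraph \<Rightarrow> bool" where
  "graph_le \<Gamma> \<Delta> \<longleftrightarrow> (\<exists>S. subgraph S \<Delta> \<and> digraph_iso \<Gamma> S)"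

definition laplacian_mat :: "('v, 'e) pre_digraph \<Rightarrow> 'v list \<Rightarrow> real mat" where
  "laplacian_mat \<Gamma> vs = mat (length vs) (length vs) (\<lambda>(i, j).
     if i = j then real (out_degree \<Gamma> (vs ! i))
     else if vs ! i \<rightarrow>\<^bsub>\<Gamma>\<^esub> vs ! j then - 1 else 0)"

text \<open>
  Different enumerations of the vertices give permutation-similar matrices, so the
  characteristic polynomial does not depend on the choice. The matrix is real symmetric, so
  all complex eigenvalues are counted among its real ones.
\<close>

definition laplacian_spectrum :: "('v, 'e) pre_digraph \<Rightarrow> real multiset" where
  "laplacian_spectrum \<Gamma> =
     proots (char_poly (laplacian_mat \<Gamma> (SOME vs. distinct vs \<and> set vs = verts \<Gamma>)))"

definition eigenvalues_partition :: "('v, 'e) pre_digraph \<Rightarrow> real list" where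
  "eigenvalues_partition \<Gamma> =
     rev (sorted_list_of_multiset (filter_mset (\<lambda>x. x \<noteq> 0) (laplacian_spectrum \<Gamma>)))"

text \<open>
  Rows and columns are numbered from 0. An integer part \<open>k\<close> contributes the boxes in
  columns \<open>0, \<dots>, k - 1\<close>; the Laplacian eigenvalues of the threshold graphs considered here are
  integers, although their type is \<open>real\<close>.
\<close>

definition young_diagram :: "real list \<Rightarrow> (nat \<times> nat) set" where
  "young_diagram \<pi> = {(i, j). i < length \<pi> \<and> real j < \<pi> ! i}"

definition fits_in :: "(nat \<times> nat) set \<Rightarrow> (nat \<times> nat) set \<Rightarrow> bool" where
  "fits_in Y Z \<longleftrightarrow> Y \<subseteq> Z"

end

theory Submission
  imports Defs
begin

text \<open>
  The group-annihilator graph of \<open>\<Z>/q\<^sup>m\<Z>\<close> is a threshold graph: elements of valuation \<open>i\<close> and \<open>j\<close>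
  are joined if and only if \<open>i + j \<ge> m\<close>. The theorem is a property of arbitrary threshold graphs
  without isolated vertices (\<open>threshold_embedding_iff_young_diagram\<close>), and such a
  graph is determined by its degrees.

  First, the Young diagram of the Laplacian eigenvalues of a threshold graph is the transpose of the
  diagram of its degrees (\<open>young_diagram_threshold_graph\<close>). A threshold graph is built by
  successively adding isolated or dominating vertices. With respect to the indicator vectors
  of the successive vertex sets, the Laplacian is triangular with an explicit diagonal
  (\<open>threshold_laplacian_roots\<close>), and an induction over the construction
  shows that this diagonal is conjugate to the degree sequence
  (\<open>construction_spectrum_conjugate\<close>). Containment of the eigenvalue diagrams
  therefore means that for every \<open>i\<close> the graph \<open>\<Gamma>\<close> has at most as many vertices of degree above \<open>i\<close> as
  the graph \<open>\<Delta>\<close>.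

  Secondly, this comparison of degrees is equivalent to \<open>\<Gamma>\<close> being a subgraph of \<open>\<Delta>\<close>. A subgraph
  has no larger degrees. Conversely, order the vertices of both graphs by decreasing degree; the
  vertices at positions \<open>i < j\<close>, counted from 0, are joined if and only if the degree at position \<open>i\<close> is at
  least \<open>j\<close> (\<open>threshold_degree_order\<close>). Hence larger degrees give more edges, and
  matching equal positions embeds \<open>\<Gamma>\<close> into \<open>\<Delta>\<close> (\<open>threshold_embedding_of_degrees\<close>).
\<close>

section \<open>Degrees and eigenvalues of a threshold construction\<close>

text \<open>
  A threshold graph arises by adding vertices \<open>0, 1, \<dots>, N - 1\<close> one at a time, vertex \<open>k\<close> being joined
  to all earlier vertices if \<open>b k\<close> holds and to none of them otherwise. The value defined here is
  the final degree of vertex \<open>k\<close>.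
\<close>

definition construction_degree :: "nat \<Rightarrow> (nat \<Rightarrow> bool) \<Rightarrow> nat \<Rightarrow> nat" where
  "construction_degree N b k = k * of_bool (b k) + (\<Sum>l\<in>{k<..<N}. of_bool (b l))"

lemma construction_degree_Suc:
  assumes "k < N"
  shows "construction_degree (Suc N) b k = construction_degree N b k + of_bool (b N)"
proof -
  have "{k<..<Suc N} = insert N {k<..<N}" using assms by auto
  then show ?thesis by (simp add: construction_degree_def)
qed

lemma construction_degree_last: "construction_degree (Suc N) b N = N * of_bool (b N)"
proof -
  have "{N<..<Suc N} = {}" by auto
  then show ?thesis by (simp add: construction_degree_def)
qed

lemma construction_degree_less:
  assumes "k < N"
  shows "construction_degree N b k < N"
proof -
  have "(\<Sum>l\<in>{k<..<N}. of_bool (b l)) \<le> (\<Sum>l\<in>{k<..<N}. 1 :: nat)"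
    by (rule sum_mono) simp
  moreover have "k * of_bool (b k) \<le> k" by simp
  ultimately show ?thesis
    using assms unfolding construction_degree_def by (cases "b k") simp_all
qed

text \<open>
  The numbers \<open>d\<^sub>k + [b k]\<close> for \<open>1 \<le> k < N\<close> will turn out to be the Laplacian eigenvalues apart from
  one 0. They form the partition conjugate to the degrees: adding an isolated vertex changes
  neither diagram, and adding a dominating vertex raises all old entries of both sequences by one
  and adds one entry to each, \<open>N\<close> to the degrees and \<open>N + 1\<close> to the eigenvalues. In both diagrams
  this puts a new hook in front of the old diagram, with its arms exchanged.
\<close>

lemma construction_spectrum_conjugate:
  assumes "1 \<le> N"
  shows "i < card {k \<in> {1..<N}. j < construction_degree N b k + of_bool (b k)} \<longleftrightarrow>
    j < card {k \<in> {..<N}. i < construction_degree N b k}"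
  using assms
proof (induction N arbitrary: i j rule: dec_induct)
  case base
  have "{k \<in> {..<1}. i < construction_degree 1 b k} = {}"
    using construction_degree_less[of _ 1 b] by fastforce
  then show ?case by (simp only:) simp
next
  case (step N)
  let ?A = "\<lambda>j. {k \<in> {1..<N}. j < construction_degree N b k + of_bool (b k)}"
  let ?D = "\<lambda>i. {k \<in> {..<N}. i < construction_degree N b k}"
  let ?A' = "{k \<in> {1..<Suc N}. j < construction_degree (Suc N) b k + of_bool (b k)}"
  let ?D' = "{k \<in> {..<Suc N}. i < construction_degree (Suc N) b k}"
  have split: "{1..<Suc N} = insert N {1..<N}" "{..<Suc N} = insert N {..<N}"
    using step.hyps by auto
  show ?case
  proof (cases "b N")
    case False
    have "?A' = ?A j" "?D' = ?D i"
      unfolding split using False construction_degree_last[of N b]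
      by (auto simp: construction_degree_Suc)
    then show ?thesis using step.IH by simp
  next
    case True
    have cA: "card (?A j') \<le> N - 1" for j'
      by (rule order_trans[OF card_mono[of "{1..<N}"]]) auto
    have cD: "card (?D i') \<le> N" for i'
      by (rule order_trans[OF card_mono[of "{..<N}"]]) auto
    have eA: "?A j' = {}" if "N \<le> j'" for j'
    proof -
      have "construction_degree N b k + of_bool (b k) \<le> j'" if "k \<in> {1..<N}" for k
        using construction_degree_less[of k N b] that \<open>N \<le> j'\<close> by (cases "b k") auto
      then show ?thesis by fastforce
    qed
    have eD: "?D i' = {}" if "N \<le> Suc i'" for i'
      using construction_degree_less[of _ N b] that by fastforce
    \<comment> \<open>Level 0 catches every entry; a higher level catches what the old
      sequence had one level below, and the entry of the new vertex.\<close>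
    have A': "?A' = (if j = 0 then {1..<Suc N} else ?A (j - 1) \<union> (if j \<le> N then {N} else {}))"
      unfolding split using True construction_degree_last[of N b] step.hyps
      by (auto simp: construction_degree_Suc)
    have D': "?D' = (if i = 0 then {..<Suc N} else ?D (i - 1) \<union> (if i < N then {N} else {}))"
      unfolding split using True construction_degree_last[of N b] step.hyps
      by (auto simp: construction_degree_Suc)
    have cA': "card ?A' = (if j = 0 then N else card (?A (j - 1)) + of_bool (j \<le> N))"
      unfolding A' by simp
    have cD': "card ?D' = (if i = 0 then Suc N else card (?D (i - 1)) + of_bool (i < N))"
      unfolding D' by simp
    show ?thesis
    proof (cases "i = 0 \<or> j = 0")
      case True
      then show ?thesis
        unfolding cA' cD' using eA[of "j - 1"] eD[of "i - 1"] step.hyps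
        by (auto simp: not_le not_less)
    next
      case False
      have arith: "Suc i' < x + of_bool (Suc j' \<le> N) \<longleftrightarrow> Suc j' < y + of_bool (Suc i' < N)"
        if "x \<le> N - 1" "y \<le> N" "N \<le> j' \<Longrightarrow> x = card {}" "N \<le> Suc i' \<Longrightarrow> y = card {}"
          "\<not> (Suc i' < N \<and> Suc j' \<le> N)" for x y i' j'
        using that by (cases "Suc i' < N"; cases "Suc j' \<le> N") auto
      obtain i' j' where ij: "i = Suc i'" "j = Suc j'"
        using False by (metis not0_implies_Suc)
      show ?thesis
      proof (cases "i < N \<and> j \<le> N")
        case True
        then show ?thesis unfolding cA' cD' using step.IH[of i' j'] by (simp add: ij)
      next
        case False
        then show ?thesis
          unfolding cA' cD' unfolding ij
          using arith[where i' = i' and j' = j', OF cA[of j'] cD[of i'] arg_cong[OF eA[of j'], of card]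
              arg_cong[OF eD[of i'], of card]]
          by (simp add: ij)
      qed
    qed
  qed
qed

section \<open>The Laplacian spectrum along a construction order\<close>

lemma char_poly_reindex:
  fixes A :: "'a :: comm_ring_1 mat"
  assumes A: "A \<in> carrier_mat n n" and f: "f permutes {0..<n}"
  shows "char_poly (mat n n (\<lambda>(i, j). A $$ (f i, f j))) = char_poly A"
proof -
  let ?C = "char_poly_matrix A"
  let ?R = "mat n n (\<lambda>(i, j). ?C\<^sup>T $$ (f i, j))"
  have C: "?C \<in> carrier_mat n n" using A by simp
  have f_less: "f i < n" if "i < n" for i
    using permutes_in_image[OF f, of i] that by simp
  have f_eq: "f i = f j \<longleftrightarrow> i = j" for i j
    using permutes_inj[OF f] by (auto dest: injD)
  have "char_poly_matrix (mat n n (\<lambda>(i, j). A $$ (f i, f j))) =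
      mat n n (\<lambda>(i, j). ?R\<^sup>T $$ (f i, j))"
    by (rule eq_matI) (use A f_less f_eq in \<open>auto simp: char_poly_matrix_def\<close>)
  then have "char_poly (mat n n (\<lambda>(i, j). A $$ (f i, f j))) = signof f * det (?R\<^sup>T)"
    unfolding char_poly_def by (simp add: det_permute_rows[OF _ f])
  also have "det (?R\<^sup>T) = signof f * det ?C"
    using C by (subst det_transpose[of _ n])
      (simp_all add: det_permute_rows[OF _ f] det_transpose[OF C])
  also have "signof f * (signof f * det ?C) = det ?C"
    by (simp add: sign_def)
  finally show ?thesis by (simp add: char_poly_def)
qed

text \<open>
  The spectrum is defined through an unspecified enumeration of the vertices; this lemma allows
  it to be computed along the construction order of a threshold graph instead.
\<close>

lemma laplacian_char_poly_order_independent: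
  assumes "distinct vs" "distinct ks" "set vs = set ks"
  shows "char_poly (laplacian_mat \<Gamma> vs) = char_poly (laplacian_mat \<Gamma> ks)"
proof -
  have "mset vs = mset ks"
    using assms by (simp add: set_eq_iff_mset_eq_distinct)
  then obtain f where f: "f permutes {..<length ks}" and vs: "permute_list f ks = vs"
    by (rule mset_eq_permutation)
  have f': "f permutes {0..<length ks}" using f by (simp add: atLeast0LessThan)
  have f_less: "f i < length ks" if "i < length ks" for i
    using permutes_in_image[OF f, of i] that by simp
  have f_eq: "f i = f j \<longleftrightarrow> i = j" for i j
    using permutes_inj[OF f] by (auto dest: injD)
  have "laplacian_mat \<Gamma> vs =
      mat (length ks) (length ks) (\<lambda>(i, j). laplacian_mat \<Gamma> ks $$ (f i, f j))"
    by (rule eq_matI)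
      (use f_less f_eq in \<open>auto simp: laplacian_mat_def vs[symmetric] permute_list_nth[OF f]\<close>)
  then show ?thesis
    by (simp add: char_poly_reindex[OF _ f'] laplacian_mat_def)
qed

text \<open>
  In the basis of the indicator vectors of the initial segments \<open>{0, \<dots>, k}\<close> the Laplacian of a
  construction sequence is lower triangular. Indeed, the row sums over such a segment vanish in the
  rows \<open>i \<le> k\<close> except for the edges leaving the segment, of which there are
  \<open>\<Sum>\<^bsub>l > k\<^esub> c\<^sub>l\<close> at each of its vertices, and they are \<open>- (k + 1) c\<^sub>i\<close> in the rows \<open>i > k\<close>.
  So the image is constant on the segment and involves only the segments ending at \<open>k\<close> or later.
\<close>

lemma threshold_laplacian_roots:
  fixes c :: "nat \<Rightarrow> real"
  defines "B \<equiv> \<lambda>k N. \<Sum>l\<in>{k<..<N}. c l"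
  shows "proots (char_poly (mat N N (\<lambda>(i, j).
      if i = j then i * c i + B i N else - c (max i j)))) =
    mset (map (\<lambda>k. B k N + (if Suc k < N then (k + 1) * c (Suc k) else 0)) [0..<N])"
proof -
  define L where "L = mat N N (\<lambda>(i, j). if i = j then i * c i + B i N else - c (max i j))"
  define U where "U = mat N N (\<lambda>(i, j). if i \<le> j then 1 else 0 :: real)"
  define V where "V = mat N N (\<lambda>(i, j). if i = j then 1 else if j = Suc i then -1 else 0 :: real)"
  define M where "M = mat N N (\<lambda>(i, k). if i \<le> k then B k N else - (real k + 1) * c i)"
  have carrier: "L \<in> carrier_mat N N" "U \<in> carrier_mat N N" "V \<in> carrier_mat N N"
      "M \<in> carrier_mat N N"
    by (simp_all add: L_def U_def V_def M_def)
  \<comment> \<open>The columns of U are the indicator vectors of the initial segments; V is the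
    inverse of U and subtracts from each row the next one.\<close>
  have V_mult: "(V * X) $$ (i, k) = X $$ (i, k) - (if Suc i < N then X $$ (Suc i, k) else 0)"
    if X: "X \<in> carrier_mat N N" and ik: "i < N" "k < N" for X i k
  proof -
    have "(V * X) $$ (i, k) = (\<Sum>j\<in>{0..<N}. V $$ (i, j) * X $$ (j, k))"
      using X ik carrier by (simp add: scalar_prod_def)
    also have "\<dots> = (\<Sum>j\<in>{0..<N}. (if j = i then X $$ (j, k) else 0)
        - (if j = Suc i then X $$ (j, k) else 0))"
      using ik by (intro sum.cong) (auto simp: V_def)
    also have "\<dots> = X $$ (i, k) - (if Suc i < N then X $$ (Suc i, k) else 0)"
      using ik by (simp add: sum_subtractf)
    finally show ?thesis .
  qed
  have VU: "V * U = 1\<^sub>m N"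
  proof (rule eq_matI)
    fix i k assume "i < dim_row (1\<^sub>m N :: real mat)" "k < dim_col (1\<^sub>m N :: real mat)"
    then have ik: "i < N" "k < N" by simp_all
    show "(V * U) $$ (i, k) = 1\<^sub>m N $$ (i, k)"
      unfolding V_mult[OF carrier(2) ik] using ik by (auto simp: U_def)
  qed (use carrier in auto)
  have UV: "U * V = 1\<^sub>m N"
    by (rule mat_mult_left_right_inverse[OF carrier(3,2) VU])
  have LU: "L * U = M"
  proof (rule eq_matI)
    fix i k assume "i < dim_row M" "k < dim_col M"
    then have ik: "i < N" "k < N" using carrier by auto
    have "(L * U) $$ (i, k) = (\<Sum>j\<in>{0..<N}. L $$ (i, j) * U $$ (j, k))"
      using ik carrier by (simp add: scalar_prod_def)
    also have "\<dots> = (\<Sum>j\<in>{0..k}. L $$ (i, j))"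
      using ik by (intro sum.mono_neutral_cong_right) (auto simp: U_def)
    also have "\<dots> = M $$ (i, k)"
    proof (cases "i \<le> k")
      case True
      have "{0..k} = insert i ({0..<i} \<union> {i<..k})" using True by auto
      then have "(\<Sum>j\<in>{0..k}. L $$ (i, j)) =
          L $$ (i, i) + ((\<Sum>j\<in>{0..<i}. L $$ (i, j)) + (\<Sum>j\<in>{i<..k}. L $$ (i, j)))"
        by (simp add: sum.union_disjoint disjoint_iff)
      also have "(\<Sum>j\<in>{0..<i}. L $$ (i, j)) = (\<Sum>j\<in>{0..<i}. - c i)"
        using ik by (intro sum.cong) (auto simp: L_def max_def)
      also have "(\<Sum>j\<in>{i<..k}. L $$ (i, j)) = (\<Sum>j\<in>{i<..k}. - c j)"
        using ik by (intro sum.cong) (auto simp: L_def max_def)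
      also have "B i N = (\<Sum>j\<in>{i<..k}. c j) + B k N"
      proof -
        have "{i<..<N} = {i<..k} \<union> {k<..<N}" using True ik by auto
        then show ?thesis by (simp add: B_def sum.union_disjoint disjoint_iff)
      qed
      then have "L $$ (i, i) + ((\<Sum>j\<in>{0..<i}. - c i) + (\<Sum>j\<in>{i<..k}. - c j)) = B k N"
        using ik by (simp add: L_def sum_negf)
      finally show ?thesis using True ik by (simp add: M_def)
    next
      case False
      have "(\<Sum>j\<in>{0..k}. L $$ (i, j)) = (\<Sum>j\<in>{0..k}. - c i)"
        using ik False by (intro sum.cong) (auto simp: L_def max_def)
      then show ?thesis using False ik by (simp add: M_def algebra_simps)
    qed
    finally show "(L * U) $$ (i, k) = M $$ (i, k)" .
  qed (use carrier in auto)
  define T where "T = V * M"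
  have T: "T \<in> carrier_mat N N" using carrier by (simp add: T_def)
  have T_entry: "T $$ (i, k) = M $$ (i, k) - (if Suc i < N then M $$ (Suc i, k) else 0)"
    if "i < N" "k < N" for i k
    unfolding T_def using that by (rule V_mult[OF carrier(4)])
  have "U * T * V = (U * V) * L * (U * V)"
    unfolding T_def LU[symmetric] using carrier by (simp add: assoc_mult_mat[of _ N N _ N _ N])
  then have "L = U * T * V" using carrier by (simp add: UV)
  then have "similar_mat L T"
    using carrier T UV VU by (intro similar_matI[of L T U V N]) auto
  then have "char_poly L = char_poly T" by (rule char_poly_similar)
  also have "\<dots> = char_poly (T\<^sup>T)" using T by simp
  also have "upper_triangular (T\<^sup>T)"
    using T by (auto simp: T_entry M_def upper_triangular_def)
  then have "char_poly (T\<^sup>T) = (\<Prod>a\<leftarrow>diag_mat (T\<^sup>T). [:- a, 1:])"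
    using T by (intro char_poly_upper_triangular[of _ N]) auto
  also have "diag_mat (T\<^sup>T) = map (\<lambda>k. B k N + (if Suc k < N then (k + 1) * c (Suc k) else 0)) [0..<N]"
    using T by (auto simp: diag_mat_def T_entry M_def algebra_simps)
  finally have cp: "char_poly L = (\<Prod>a\<leftarrow>map (\<lambda>k. B k N + (if Suc k < N then (k + 1) * c (Suc k) else 0)) [0..<N]. [:- a, 1:])" .
  have roots: "proots (\<Prod>a\<leftarrow>as. [:- a, 1:]) = mset as" for as :: "real list"
  proof (induction as)
    case (Cons a as)
    have "(\<Prod>a\<leftarrow>as. [:- a, 1:]) \<noteq> 0" by (auto simp: prod_list_zero_iff)
    then have "proots ([:- a, 1:] * (\<Prod>a\<leftarrow>as. [:- a, 1:])) = {#a#} + mset as"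
      using Cons.IH by (subst proots_mult) auto
    then show ?case by (simp del: mult_pCons_left)
  qed simp
  show ?thesis using cp unfolding L_def roots by (simp only: roots)
qed

text \<open>
  A Young diagram depends only on how many parts exceed each number, which avoids any further
  reference to sorted lists of eigenvalues.
\<close>

lemma young_diagram_of_multiset:
  "(i, j) \<in> young_diagram (rev (sorted_list_of_multiset (filter_mset (\<lambda>x. x \<noteq> 0) M))) \<longleftrightarrow>
    i < size {#x \<in># M. real j < x#}"
proof -
  have nth_rev_sorted: "i < length xs \<and> a < rev xs ! i \<longleftrightarrow> i < length (filter (\<lambda>x. a < x) xs)"
    if "sorted xs" for xs :: "real list" and a
    using that
  proof (induction xs)
    case (Cons x xs)
    show ?case
    proof (cases "a < x")
      case True
      then have "\<forall>y\<in>set (x # xs). a < y" using Cons.prems by auto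
      then have "filter (\<lambda>x. a < x) (x # xs) = x # xs" by (intro filter_True) auto
      moreover have "a < rev (x # xs) ! i" if "i < length (x # xs)"
        using \<open>\<forall>y\<in>set (x # xs). a < y\<close> that by (metis length_rev nth_mem set_rev)
      ultimately show ?thesis by auto
    next
      case False
      then show ?thesis
        using Cons.IH Cons.prems
        by (cases "i < length xs")
          (auto simp: nth_append less_Suc_eq dest: less_le_trans[OF _ length_filter_le])
    qed
  qed simp
  let ?xs = "sorted_list_of_multiset (filter_mset (\<lambda>x. x \<noteq> 0) M)"
  have "filter_mset (\<lambda>x. real j < x) (filter_mset (\<lambda>x. x \<noteq> 0) M) = filter_mset (\<lambda>x. real j < x) M"
    by (auto simp: filter_filter_mset intro: filter_mset_cong)
  then have "length (filter (\<lambda>x. real j < x) ?xs) = size {#x \<in># M. real j < x#}"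
    by (metis mset_filter mset_sorted_list_of_multiset size_mset)
  then show ?thesis
    using nth_rev_sorted[of ?xs "real j"] by (auto simp: young_diagram_def)
qed

section \<open>Threshold graphs and their Young diagrams\<close>

text \<open>
  Weighted threshold description: vertices are joined if and only if the sum of their weights
  reaches \<open>t\<close>. For \<open>\<Z>/p\<^sup>m\<Z>\<close> the weights are the \<open>p\<close>-adic valuations and \<open>t = m\<close>.
\<close>

definition threshold_graph :: "('v, 'e) pre_digraph \<Rightarrow> ('v \<Rightarrow> int) \<Rightarrow> int \<Rightarrow> bool" where
  "threshold_graph \<Gamma> w t \<longleftrightarrow> graph \<Gamma> \<and>
     (\<forall>u\<in>verts \<Gamma>. \<forall>v\<in>verts \<Gamma>. u \<rightarrow>\<^bsub>\<Gamma>\<^esub> v \<longleftrightarrow> u \<noteq> v \<and> t \<le> w u + w v)"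

lemma (in graph) out_degree_eq_card_neighbours:
  "out_degree G u = card {v \<in> verts G. u \<rightarrow>\<^bsub>G\<^esub> v}"
proof -
  have "bij_betw (head G) (out_arcs G u) {v \<in> verts G. u \<rightarrow>\<^bsub>G\<^esub> v}"
    unfolding bij_betw_def
  proof
    show "inj_on (head G) (out_arcs G u)"
      by (rule inj_onI) (auto intro!: no_multi_arcs simp: arc_to_ends_def)
    show "head G ` out_arcs G u = {v \<in> verts G. u \<rightarrow>\<^bsub>G\<^esub> v}"
      by (auto simp: arcs_ends_conv image_iff)
  qed
  then show ?thesis unfolding out_degree_def by (rule bij_betw_same_card)
qed

lemma finite_verts_graph: "graph \<Gamma> \<Longrightarrow> finite (verts \<Gamma>)"
  by (simp add: graph_def digraph_def fin_digraph.finite_verts)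

lemma out_degree_along_enumeration:
  assumes "graph \<Gamma>" "distinct ks" "set ks = verts \<Gamma>"
  shows "out_degree \<Gamma> u = card {j. j < length ks \<and> u \<rightarrow>\<^bsub>\<Gamma>\<^esub> ks ! j}"
proof -
  have "bij_betw (\<lambda>j. ks ! j) {j. j < length ks \<and> u \<rightarrow>\<^bsub>\<Gamma>\<^esub> ks ! j} {v \<in> verts \<Gamma>. u \<rightarrow>\<^bsub>\<Gamma>\<^esub> v}"
    using assms(2,3) unfolding bij_betw_def
    by (auto simp: inj_on_def nth_eq_iff_index_eq image_iff in_set_conv_nth assms(3)[symmetric])
  then show ?thesis
    unfolding graph.out_degree_eq_card_neighbours[OF assms(1)]
    by (rule bij_betw_same_card[symmetric])
qed

lemma card_verts_along_enumeration:
  assumes "distinct ks" "set ks = verts \<Gamma>"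
  shows "card {v \<in> verts \<Gamma>. P v} = card {k. k < length ks \<and> P (ks ! k)}"
proof -
  have "bij_betw (\<lambda>j. ks ! j) {j. j < length ks \<and> P (ks ! j)} {v \<in> verts \<Gamma>. P v}"
    using assms unfolding bij_betw_def
    by (auto simp: inj_on_def nth_eq_iff_index_eq image_iff in_set_conv_nth assms(2)[symmetric])
  then show ?thesis by (rule bij_betw_same_card[symmetric])
qed

text \<open>
  A vertex \<open>v\<close> with \<open>2 w v \<ge> t\<close> is joined to every \<open>u\<close> with \<open>\<bar>2 w u - t\<bar> \<le> 2 w v - t\<close>, and a vertex \<open>v\<close> with
  \<open>2 w v < t\<close> to no \<open>u\<close> with \<open>\<bar>2 w u - t\<bar> < t - 2 w v\<close>. So if the vertices are added in the order of
  the distance of \<open>2 w v\<close> from \<open>t\<close>, those of the first kind dominate and those of the second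
  kind are isolated on arrival.
\<close>

lemma threshold_construction_order:
  assumes "threshold_graph \<Gamma> w t"
  obtains ks b where "distinct ks" "set ks = verts \<Gamma>"
    "\<And>i j. \<lbrakk>i < length ks; j < length ks; i \<noteq> j\<rbrakk> \<Longrightarrow> ks ! i \<rightarrow>\<^bsub>\<Gamma>\<^esub> ks ! j \<longleftrightarrow> b (max i j)"
proof -
  have fin: "finite (verts \<Gamma>)"
    using assms finite_verts_graph by (auto simp: threshold_graph_def)
  then obtain xs where xs: "set xs = verts \<Gamma>" "distinct xs"
    using finite_distinct_list by blast
  define key where "key u = (if t \<le> 2 * w u then 2 * (2 * w u - t) + 1 else 2 * (t - 2 * w u))" for u
  \<comment> \<open>The key is twice the distance of 2 w u from t; the summand 1 breaks ties, since of two
    vertices u, v with w u + w v = t the heavier one has to come last to dominate the other.\<close>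
  define ks where "ks = sort_key key xs"
  define b where "b k \<longleftrightarrow> t \<le> 2 * w (ks ! k)" for k
  have ks: "distinct ks" "set ks = verts \<Gamma>" using xs by (simp_all add: ks_def)
  have "sorted (map key ks)" by (simp add: ks_def)
  then have mono: "key (ks ! i) \<le> key (ks ! j)" if "i < j" "j < length ks" for i j
    using that by (auto dest!: sorted_nth_mono[of _ i j])
  have adj: "ks ! i \<rightarrow>\<^bsub>\<Gamma>\<^esub> ks ! j \<longleftrightarrow> t \<le> w (ks ! i) + w (ks ! j)"
    if "i < length ks" "j < length ks" "i \<noteq> j" for i j
    using assms that ks unfolding threshold_graph_def by (metis nth_mem nth_eq_iff_index_eq)
  have later: "t \<le> w (ks ! i) + w (ks ! j) \<longleftrightarrow> b j" if "i < j" "j < length ks" for i j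
    using mono[OF that] unfolding key_def b_def by (auto split: if_splits)
  have "t \<le> w (ks ! i) + w (ks ! j) \<longleftrightarrow> b (max i j)"
    if "i < length ks" "j < length ks" "i \<noteq> j" for i j
    using that
  proof (cases i j rule: linorder_cases)
    case greater
    then show ?thesis using later[of j i] that
      by (simp add: add.commute)
  qed (use later in auto)
  then show thesis using adj ks by (intro that[of ks b]) auto
qed

lemma out_degree_construction_order:
  assumes "graph \<Gamma>" "distinct ks" "set ks = verts \<Gamma>" and k: "k < length ks"
    and adj: "\<And>i j. \<lbrakk>i < length ks; j < length ks; i \<noteq> j\<rbrakk> \<Longrightarrow> ks ! i \<rightarrow>\<^bsub>\<Gamma>\<^esub> ks ! j \<longleftrightarrow> b (max i j)"
  shows "out_degree \<Gamma> (ks ! k) = construction_degree (length ks) b k"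
proof -
  interpret graph \<Gamma> by fact
  have irrefl: "\<not> ks ! k \<rightarrow>\<^bsub>\<Gamma>\<^esub> ks ! k" by (auto simp: arcs_ends_conv dest: no_loops)
  have "j < length ks \<and> ks ! k \<rightarrow>\<^bsub>\<Gamma>\<^esub> ks ! j \<longleftrightarrow>
      j \<in> (if b k then {..<k} else {}) \<union> {l \<in> {k<..<length ks}. b l}" for j
    using irrefl adj[OF k, of j] k by (cases j k rule: linorder_cases) (auto simp: max_def)
  then have "{j. j < length ks \<and> ks ! k \<rightarrow>\<^bsub>\<Gamma>\<^esub> ks ! j} =
      (if b k then {..<k} else {}) \<union> {l \<in> {k<..<length ks}. b l}"
    by blast
  moreover have "card \<dots> = card (if b k then {..<k} else {}) + card {l \<in> {k<..<length ks}. b l}"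
    by (rule card_Un_disjoint) auto
  moreover have "card {l \<in> {k<..<length ks}. b l} = (\<Sum>l\<in>{k<..<length ks}. of_bool (b l))"
    by (subst sum_of_bool_eq) (auto intro!: arg_cong[of _ _ card])
  ultimately show ?thesis
    unfolding out_degree_along_enumeration[OF assms(1-3)] construction_degree_def by simp
qed

lemma size_filter_mset_map_upt:
  "size {#x \<in># mset (map g [0..<N]). P x#} = card {k. k < N \<and> P (g k)}"
proof -
  have "{i. i < length (map g [0..<N]) \<and> P (map g [0..<N] ! i)} = {k. k < N \<and> P (g k)}"
    by auto
  then show ?thesis
    by (simp only: mset_filter[symmetric] size_mset length_filter_conv_card)
qed

text \<open>
  Merris' conjugacy theorem for threshold graphs: the Young diagram of the Laplacian eigenvalues
  is the transpose of the Young diagram of the degrees.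
\<close>

lemma young_diagram_threshold_graph:
  assumes thr: "threshold_graph \<Gamma> w t" and ne: "verts \<Gamma> \<noteq> {}"
  shows "(i, j) \<in> young_diagram (eigenvalues_partition \<Gamma>) \<longleftrightarrow>
    j < card {v \<in> verts \<Gamma>. i < out_degree \<Gamma> v}"
proof -
  have \<Gamma>: "graph \<Gamma>" using thr by (simp add: threshold_graph_def)
  obtain ks b where ks: "distinct ks" "set ks = verts \<Gamma>" and adj:
    "\<And>i j. \<lbrakk>i < length ks; j < length ks; i \<noteq> j\<rbrakk> \<Longrightarrow> ks ! i \<rightarrow>\<^bsub>\<Gamma>\<^esub> ks ! j \<longleftrightarrow> b (max i j)"
    using threshold_construction_order[OF thr] by metis
  let ?N = "length ks"
  let ?c = "\<lambda>k. of_bool (b k) :: real"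
  let ?d = "construction_degree ?N b"
  have N: "1 \<le> ?N" using ks ne by (cases ks) auto
  have deg: "out_degree \<Gamma> (ks ! k) = ?d k" if "k < ?N" for k
    using out_degree_construction_order[OF \<Gamma> ks that adj] .
  have real_deg: "real (?d k) = k * ?c k + (\<Sum>l\<in>{k<..<?N}. ?c l)" for k
    by (simp add: construction_degree_def)
  have "laplacian_mat \<Gamma> ks = mat ?N ?N (\<lambda>(i, j).
      if i = j then i * ?c i + (\<Sum>l\<in>{i<..<?N}. ?c l) else - ?c (max i j))"
    by (rule eq_matI) (auto simp: laplacian_mat_def deg real_deg adj simp del: sum_of_bool_eq)
  moreover have "laplacian_spectrum \<Gamma> = proots (char_poly (laplacian_mat \<Gamma> ks))"
  proof -
    let ?vs = "SOME vs. distinct vs \<and> set vs = verts \<Gamma>"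
    have "distinct ?vs \<and> set ?vs = verts \<Gamma>"
      using ks by (intro someI[of "\<lambda>vs. distinct vs \<and> set vs = verts \<Gamma>" ks]) simp
    then show ?thesis
      unfolding laplacian_spectrum_def
      using laplacian_char_poly_order_independent[of ?vs ks \<Gamma>] ks by simp
  qed
  ultimately have "laplacian_spectrum \<Gamma> = mset (map (\<lambda>k. (\<Sum>l\<in>{k<..<?N}. ?c l)
      + (if Suc k < ?N then (k + 1) * ?c (Suc k) else 0)) [0..<?N])"
    using threshold_laplacian_roots[of ?N ?c] by simp
  also have "map (\<lambda>k. (\<Sum>l\<in>{k<..<?N}. ?c l)
      + (if Suc k < ?N then (k + 1) * ?c (Suc k) else 0)) [0..<?N] =
    map (\<lambda>k. if Suc k < ?N then real (?d (Suc k) + of_bool (b (Suc k))) else 0) [0..<?N]"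
  proof (rule map_cong[OF refl])
    fix k assume "k \<in> set [0..<?N]"
    then have k: "k < ?N" by simp
    show "(\<Sum>l\<in>{k<..<?N}. ?c l) + (if Suc k < ?N then (k + 1) * ?c (Suc k) else 0) =
        (if Suc k < ?N then real (?d (Suc k) + of_bool (b (Suc k))) else 0)"
    proof (cases "Suc k < ?N")
      case True
      then have "{k<..<?N} = insert (Suc k) {Suc k<..<?N}" by auto
      then have "(\<Sum>l\<in>{k<..<?N}. ?c l) = ?c (Suc k) + (\<Sum>l\<in>{Suc k<..<?N}. ?c l)"
        by (simp del: sum_of_bool_eq)
      then show ?thesis
        using True real_deg[of "Suc k"] by (simp del: sum_of_bool_eq)
    next
      case False
      then have "{k<..<?N} = {}" by auto
      then show ?thesis using False by simp
    qed
  qed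
  finally have spec: "laplacian_spectrum \<Gamma> = mset (map (\<lambda>k.
      if Suc k < ?N then real (?d (Suc k) + of_bool (b (Suc k))) else 0) [0..<?N])" .
  have "size {#x \<in># laplacian_spectrum \<Gamma>. real j < x#} =
      card {k. k < ?N \<and> real j < (if Suc k < ?N then real (?d (Suc k) + of_bool (b (Suc k))) else 0)}"
    unfolding spec by (rule size_filter_mset_map_upt)
  also have "{k. k < ?N \<and> real j < (if Suc k < ?N then real (?d (Suc k) + of_bool (b (Suc k))) else 0)} =
      {k. Suc k < ?N \<and> j < ?d (Suc k) + of_bool (b (Suc k))}"
    by (auto simp del: of_nat_add of_nat_of_bool simp: of_nat_less_iff split: if_splits)
  also have "card \<dots> = card {k \<in> {1..<?N}. j < ?d k + of_bool (b k)}"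
  proof -
    have image: "Suc ` {k. Suc k < ?N \<and> j < ?d (Suc k) + of_bool (b (Suc k))} =
        {k \<in> {1..<?N}. j < ?d k + of_bool (b k)}"
    proof (intro equalityI subsetI)
      fix k assume k: "k \<in> {k \<in> {1..<?N}. j < ?d k + of_bool (b k)}"
      then obtain k' where "k = Suc k'" by (cases k) auto
      then show "k \<in> Suc ` {k. Suc k < ?N \<and> j < ?d (Suc k) + of_bool (b (Suc k))}"
        using k by auto
    qed auto
    show ?thesis unfolding image[symmetric] by (simp add: card_image)
  qed
  finally have "(i, j) \<in> young_diagram (eigenvalues_partition \<Gamma>) \<longleftrightarrow>
      i < card {k \<in> {1..<?N}. j < ?d k + of_bool (b k)}"
    unfolding eigenvalues_partition_def young_diagram_of_multiset by simp
  also have "\<dots> \<longleftrightarrow> j < card {k \<in> {..<?N}. i < ?d k}"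
    by (rule construction_spectrum_conjugate[OF N])
  also have "{k \<in> {..<?N}. i < ?d k} = {k. k < ?N \<and> i < out_degree \<Gamma> (ks ! k)}"
    using deg by auto
  finally show ?thesis
    unfolding card_verts_along_enumeration[OF ks] .
qed

section \<open>Embeddings of threshold graphs and degrees\<close>

definition adjacency_embedding :: "('v \<Rightarrow> 'w) \<Rightarrow> ('v, 'e) pre_digraph \<Rightarrow> ('w, 'f) pre_digraph \<Rightarrow> bool" where
  "adjacency_embedding f \<Gamma> \<Delta> \<longleftrightarrow> inj_on f (verts \<Gamma>) \<and> f ` verts \<Gamma> \<subseteq> verts \<Delta> \<and>
     (\<forall>u\<in>verts \<Gamma>. \<forall>v\<in>verts \<Gamma>. u \<rightarrow>\<^bsub>\<Gamma>\<^esub> v \<longrightarrow> f u \<rightarrow>\<^bsub>\<Delta>\<^esub> f v)"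

lemma adjacency_embedding_out_degree:
  assumes f: "adjacency_embedding f \<Gamma> \<Delta>" and \<Gamma>: "graph \<Gamma>" and \<Delta>: "graph \<Delta>"
    and u: "u \<in> verts \<Gamma>"
  shows "out_degree \<Gamma> u \<le> out_degree \<Delta> (f u)"
proof -
  have "card {v \<in> verts \<Gamma>. u \<rightarrow>\<^bsub>\<Gamma>\<^esub> v} \<le> card {v \<in> verts \<Delta>. f u \<rightarrow>\<^bsub>\<Delta>\<^esub> v}"
    by (rule card_inj_on_le[of f])
      (use f u finite_verts_graph[OF \<Delta>] in
        \<open>auto simp: adjacency_embedding_def intro: inj_on_subset\<close>)
  then show ?thesis by (simp add: graph.out_degree_eq_card_neighbours \<Gamma> \<Delta>)
qed

text \<open>
  An embedding never lowers degrees, so it maps the vertices of degree above \<open>i\<close> injectively to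
  such vertices.
\<close>

lemma adjacency_embedding_card_degrees:
  assumes f: "adjacency_embedding f \<Gamma> \<Delta>" and \<Gamma>: "graph \<Gamma>" and \<Delta>: "graph \<Delta>"
  shows "card {v \<in> verts \<Gamma>. i < out_degree \<Gamma> v} \<le> card {v \<in> verts \<Delta>. i < out_degree \<Delta> v}"
proof (rule card_inj_on_le[of f])
  show "f ` {v \<in> verts \<Gamma>. i < out_degree \<Gamma> v} \<subseteq> {v \<in> verts \<Delta>. i < out_degree \<Delta> v}"
    using f adjacency_embedding_out_degree[OF f \<Gamma> \<Delta>]
    by (auto simp: adjacency_embedding_def intro: less_le_trans)
qed (use f finite_verts_graph[OF \<Delta>] in
  \<open>auto simp: adjacency_embedding_def intro: inj_on_subset\<close>)

text \<open>
  By decreasing weight, the neighbours of each vertex form an initial segment with the vertex itself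
  removed. Hence whether the \<open>i\<close>-th vertex is joined to a later \<open>j\<close>-th one can be read off its
  degree alone: it is joined exactly to the first \<open>d\<^sub>i\<close> other vertices, and \<open>j\<close> vertices other than
  the \<open>i\<close>-th precede position \<open>j + 1\<close> when positions count from 0.
\<close>

lemma threshold_degree_order:
  assumes thr: "threshold_graph \<Gamma> w t"
  obtains ks where "distinct ks" "set ks = verts \<Gamma>"
    "\<And>i j. \<lbrakk>i < j; j < length ks\<rbrakk> \<Longrightarrow> ks ! i \<rightarrow>\<^bsub>\<Gamma>\<^esub> ks ! j \<longleftrightarrow> j \<le> out_degree \<Gamma> (ks ! i)"
    "\<And>i j. \<lbrakk>i < j; j < length ks\<rbrakk> \<Longrightarrow> out_degree \<Gamma> (ks ! j) \<le> out_degree \<Gamma> (ks ! i)"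
proof -
  have \<Gamma>: "graph \<Gamma>" using thr by (simp add: threshold_graph_def)
  then obtain xs where xs: "set xs = verts \<Gamma>" "distinct xs"
    using finite_distinct_list[OF finite_verts_graph] by blast
  define ks where "ks = sort_key (\<lambda>u. - w u) xs"
  have ks: "distinct ks" "set ks = verts \<Gamma>" using xs by (simp_all add: ks_def)
  have "sorted (map (\<lambda>u. - w u) ks)" by (simp add: ks_def)
  then have mono: "w (ks ! j) \<le> w (ks ! i)" if "i \<le> j" "j < length ks" for i j
    using that by (auto dest!: sorted_nth_mono[of _ i j])
  have adj: "ks ! i \<rightarrow>\<^bsub>\<Gamma>\<^esub> ks ! j \<longleftrightarrow> i \<noteq> j \<and> t \<le> w (ks ! i) + w (ks ! j)"
    if "i < length ks" "j < length ks" for i j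
    using thr that ks unfolding threshold_graph_def by (metis nth_mem nth_eq_iff_index_eq)
  let ?R = "\<lambda>i. {j. j < length ks \<and> ks ! i \<rightarrow>\<^bsub>\<Gamma>\<^esub> ks ! j}"
  have deg: "out_degree \<Gamma> (ks ! i) = card (?R i)" for i
    by (rule out_degree_along_enumeration[OF \<Gamma> ks])
  have fin: "finite (?R i)" for i by simp
  have "ks ! i \<rightarrow>\<^bsub>\<Gamma>\<^esub> ks ! j \<longleftrightarrow> j \<le> out_degree \<Gamma> (ks ! i)" if ij: "i < j" "j < length ks" for i j
  proof
    assume "ks ! i \<rightarrow>\<^bsub>\<Gamma>\<^esub> ks ! j"
    then have "t \<le> w (ks ! i) + w (ks ! l)" if "l \<le> j" for l
      using adj[of i j] mono[OF that] ij by simp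
    then have "{..j} - {i} \<subseteq> ?R i" using adj ij by auto
    then have "card ({..j} - {i}) \<le> out_degree \<Gamma> (ks ! i)"
      unfolding deg by (rule card_mono[OF fin])
    then show "j \<le> out_degree \<Gamma> (ks ! i)" using ij by simp
  next
    assume le: "j \<le> out_degree \<Gamma> (ks ! i)"
    show "ks ! i \<rightarrow>\<^bsub>\<Gamma>\<^esub> ks ! j"
    proof (rule ccontr)
      assume "\<not> ks ! i \<rightarrow>\<^bsub>\<Gamma>\<^esub> ks ! j"
      then have "\<not> t \<le> w (ks ! i) + w (ks ! l)" if "j \<le> l" "l < length ks" for l
        using adj[of i j] mono[OF that] ij by simp
      then have "?R i \<subseteq> {..<j} - {i}" using adj ij by (auto simp: not_le[symmetric])
      then have "out_degree \<Gamma> (ks ! i) \<le> card ({..<j} - {i})"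
        unfolding deg by (intro card_mono) auto
      then show False using le ij by simp
    qed
  qed
  moreover have "out_degree \<Gamma> (ks ! j) \<le> out_degree \<Gamma> (ks ! i)"
    if ij: "i < j" "j < length ks" for i j
    unfolding deg
  \<comment> \<open>The heavier vertex i has all neighbours of j, where the neighbour i of j
    is matched with the neighbour j of i.\<close>
  proof (rule card_inj_on_le[of "\<lambda>l. if l = i then j else l"])
    show "inj_on (\<lambda>l. if l = i then j else l) (?R j)"
      using adj ij by (auto simp: inj_on_def)
    show "(\<lambda>l. if l = i then j else l) ` ?R j \<subseteq> ?R i"
      using adj[of i] adj[of j] mono[of i j] ij by (fastforce simp: add.commute)
  qed simp
  ultimately show thesis by (intro that[of ks]) (use ks in auto)
qed

text \<open>
  Match the vertices in the order of decreasing degree. Adjacency of positions \<open>i < j\<close> says that the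
  degree at position \<open>i\<close> is at least \<open>j\<close>, a condition that is monotone in the degree sequence, and
  the sequence of \<open>\<Delta>\<close> dominates that of \<open>\<Gamma>\<close> entry by entry. Isolated vertices of \<open>\<Gamma>\<close> would not be
  seen by the counts; their absence makes \<open>i = 0\<close> yield that \<open>\<Delta>\<close> has enough vertices.
\<close>

lemma threshold_embedding_of_degrees:
  assumes \<Gamma>: "threshold_graph \<Gamma> w t" and \<Delta>: "threshold_graph \<Delta> w' t'"
    and no_isolated: "\<And>v. v \<in> verts \<Gamma> \<Longrightarrow> 0 < out_degree \<Gamma> v"
    and le: "\<And>i. card {v \<in> verts \<Gamma>. i < out_degree \<Gamma> v} \<le> card {v \<in> verts \<Delta>. i < out_degree \<Delta> v}"
  shows "\<exists>f. adjacency_embedding f \<Gamma> \<Delta>"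
proof -
  obtain ks where ks: "distinct ks" "set ks = verts \<Gamma>"
    and adj: "\<And>i j. \<lbrakk>i < j; j < length ks\<rbrakk> \<Longrightarrow> ks ! i \<rightarrow>\<^bsub>\<Gamma>\<^esub> ks ! j \<longleftrightarrow> j \<le> out_degree \<Gamma> (ks ! i)"
    and anti: "\<And>i j. \<lbrakk>i < j; j < length ks\<rbrakk> \<Longrightarrow> out_degree \<Gamma> (ks ! j) \<le> out_degree \<Gamma> (ks ! i)"
    by (rule threshold_degree_order[OF \<Gamma>]) (rule that)
  obtain ls where ls: "distinct ls" "set ls = verts \<Delta>"
    and adj': "\<And>i j. \<lbrakk>i < j; j < length ls\<rbrakk> \<Longrightarrow> ls ! i \<rightarrow>\<^bsub>\<Delta>\<^esub> ls ! j \<longleftrightarrow> j \<le> out_degree \<Delta> (ls ! i)"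
    and anti': "\<And>i j. \<lbrakk>i < j; j < length ls\<rbrakk> \<Longrightarrow> out_degree \<Delta> (ls ! j) \<le> out_degree \<Delta> (ls ! i)"
    by (rule threshold_degree_order[OF \<Delta>]) (rule that)
  note le_list = le[unfolded card_verts_along_enumeration[OF ks] card_verts_along_enumeration[OF ls]]
  have len: "length ks \<le> length ls"
  proof -
    have "{k. k < length ks \<and> 0 < out_degree \<Gamma> (ks ! k)} = {..<length ks}"
      using no_isolated[unfolded ks(2)[symmetric]] by auto
    then have "length ks \<le> card {k. k < length ls \<and> 0 < out_degree \<Delta> (ls ! k)}"
      using le_list[of 0] by simp
    also have "\<dots> \<le> card {..<length ls}" by (intro card_mono) auto
    finally show ?thesis by simp
  qed
  have adj_ls: "ls ! i \<rightarrow>\<^bsub>\<Delta>\<^esub> ls ! j"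
    if ij: "i < j" "j < length ks" and e: "ks ! i \<rightarrow>\<^bsub>\<Gamma>\<^esub> ks ! j" for i j
  proof -
    \<comment> \<open>Positions 0 to i of \<Gamma> have degree at least j, so \<Delta> has at least i + 1 vertices of degree
      at least j, and one of them is at position i or later.\<close>
    have deg: "j - 1 < out_degree \<Gamma> (ks ! l)" if "l \<le> i" for l
      using adj[OF ij] anti[of l i] e ij that by (cases "l = i") auto
    have "{..i} \<subseteq> {k. k < length ks \<and> j - 1 < out_degree \<Gamma> (ks ! k)}"
      using deg ij by auto
    then have "Suc i \<le> card {k. k < length ks \<and> j - 1 < out_degree \<Gamma> (ks ! k)}"
      using card_mono[of "{k. k < length ks \<and> j - 1 < out_degree \<Gamma> (ks ! k)}" "{..i}"] by simp
    also have "\<dots> \<le> card {k. k < length ls \<and> j - 1 < out_degree \<Delta> (ls ! k)}" by (rule le_list)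
    finally have "\<not> {k. k < length ls \<and> j - 1 < out_degree \<Delta> (ls ! k)} \<subseteq> {..<i}"
      using card_mono[of "{..<i}" "{k. k < length ls \<and> j - 1 < out_degree \<Delta> (ls ! k)}"] by auto
    then obtain k where k: "k < length ls" "j - 1 < out_degree \<Delta> (ls ! k)" "i \<le> k"
      by (auto simp: subset_iff not_less)
    then have "j \<le> out_degree \<Delta> (ls ! i)"
      using anti'[of i k] by (cases "i = k") auto
    then show ?thesis using adj'[of i j] ij len by simp
  qed
  interpret \<Gamma>: graph \<Gamma> using \<Gamma> by (simp add: threshold_graph_def)
  interpret \<Delta>: graph \<Delta> using \<Delta> by (simp add: threshold_graph_def)
  have irrefl: "\<not> u \<rightarrow>\<^bsub>\<Gamma>\<^esub> u" for u
    by (auto simp: arcs_ends_conv dest: \<Gamma>.no_loops)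
  define idx where "idx v = (THE i. i < length ks \<and> ks ! i = v)" for v
  have idx: "idx (ks ! i) = i" if "i < length ks" for i
    unfolding idx_def using that ks(1) by (intro the_equality) (auto simp: nth_eq_iff_index_eq)
  have "adjacency_embedding (\<lambda>v. ls ! idx v) \<Gamma> \<Delta>"
    unfolding adjacency_embedding_def ks(2)[symmetric]
  proof (intro conjI ballI impI)
    show "inj_on (\<lambda>v. ls ! idx v) (set ks)"
      using ls(1) len by (auto simp: inj_on_def in_set_conv_nth idx nth_eq_iff_index_eq)
    show "(\<lambda>v. ls ! idx v) ` set ks \<subseteq> verts \<Delta>"
      unfolding ls(2)[symmetric] using len by (auto simp: in_set_conv_nth[of _ ks] idx)
    fix u v assume "u \<in> set ks" "v \<in> set ks" and e: "u \<rightarrow>\<^bsub>\<Gamma>\<^esub> v"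
    then obtain i j where ij: "i < length ks" "u = ks ! i" "j < length ks" "v = ks ! j"
      by (auto simp: in_set_conv_nth)
    then have "i \<noteq> j" using e irrefl by auto
    then show "ls ! idx u \<rightarrow>\<^bsub>\<Delta>\<^esub> ls ! idx v"
      using adj_ls[of i j] adj_ls[of j i] e ij \<Gamma>.graph_symmetric \<Delta>.graph_symmetric
      by (metis idx linorder_neqE_nat)
  qed
  then show ?thesis by blast
qed

text \<open>
  Both sides are equivalent to the comparison of the numbers of vertices of degree above \<open>i\<close>, for
  all \<open>i\<close>: these numbers are the column lengths of the degree diagrams, and by conjugacy the row lengths of
  the eigenvalue diagrams.
\<close>

theorem threshold_embedding_iff_young_diagram:
  assumes \<Gamma>: "threshold_graph \<Gamma> w t" and \<Delta>: "threshold_graph \<Delta> w' t'"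
    and ne: "verts \<Gamma> \<noteq> {}" "verts \<Delta> \<noteq> {}"
    and no_isolated: "\<And>v. v \<in> verts \<Gamma> \<Longrightarrow> 0 < out_degree \<Gamma> v"
  shows "(\<exists>f. adjacency_embedding f \<Gamma> \<Delta>) \<longleftrightarrow>
    fits_in (young_diagram (eigenvalues_partition \<Gamma>)) (young_diagram (eigenvalues_partition \<Delta>))"
proof -
  let ?c = "\<lambda>i. card {v \<in> verts \<Gamma>. i < out_degree \<Gamma> v}"
  let ?d = "\<lambda>i. card {v \<in> verts \<Delta>. i < out_degree \<Delta> v}"
  have "fits_in (young_diagram (eigenvalues_partition \<Gamma>)) (young_diagram (eigenvalues_partition \<Delta>))
      \<longleftrightarrow> (\<forall>i j. j < ?c i \<longrightarrow> j < ?d i)"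
    unfolding fits_in_def subset_iff
    by (auto simp: young_diagram_threshold_graph[OF \<Gamma> ne(1)] young_diagram_threshold_graph[OF \<Delta> ne(2)])
  also have "\<dots> \<longleftrightarrow> (\<forall>i. ?c i \<le> ?d i)"
    by (meson linorder_not_less nless_le order_less_le_trans)
  also have "\<dots> \<longleftrightarrow> (\<exists>f. adjacency_embedding f \<Gamma> \<Delta>)"
    using threshold_embedding_of_degrees[OF \<Gamma> \<Delta> no_isolated]
      adjacency_embedding_card_degrees[of _ \<Gamma> \<Delta>] \<Gamma> \<Delta>
    unfolding threshold_graph_def by blast
  finally show ?thesis by simp
qed

section \<open>Subgraphs, isomorphisms and adjacency\<close>

text \<open>
  Isomorphisms of digraphs also map arcs. Given an embedding of the vertices, any choice of arcs of
  \<open>\<Delta>\<close> between the images extends it to an isomorphism onto a subgraph, because \<open>\<Gamma>\<close> has no parallel arcs.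
\<close>

lemma graph_le_iff_adjacency_embedding:
  assumes \<Gamma>: "graph \<Gamma>" and \<Delta>: "graph \<Delta>"
  shows "graph_le \<Gamma> \<Delta> \<longleftrightarrow> (\<exists>f. adjacency_embedding f \<Gamma> \<Delta>)"
proof
  assume "graph_le \<Gamma> \<Delta>"
  then obtain h where h: "pre_digraph.digraph_isomorphism \<Gamma> h" and sub: "subgraph (app_iso h \<Gamma>) \<Delta>"
    by (auto simp: graph_le_def digraph_iso_def)
  have ends: "tail \<Delta> = iso_tail h" "head \<Delta> = iso_head h"
    and arcs: "iso_arcs h ` arcs \<Gamma> \<subseteq> arcs \<Delta>"
    using sub by (auto simp: subgraph_def dest: compatible_tail compatible_head)
  have adj: "iso_verts h u \<rightarrow>\<^bsub>\<Delta>\<^esub> iso_verts h v" if uv: "u \<rightarrow>\<^bsub>\<Gamma>\<^esub> v" for u v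
  proof -
    obtain e where e: "e \<in> arcs \<Gamma>" "tail \<Gamma> e = u" "head \<Gamma> e = v"
      using uv unfolding arcs_ends_conv by blast
    have "iso_arcs h e \<in> arcs \<Delta>" using arcs e(1) by blast
    moreover have "tail \<Delta> (iso_arcs h e) = iso_verts h u" "head \<Delta> (iso_arcs h e) = iso_verts h v"
      using e h unfolding ends pre_digraph.digraph_isomorphism_def by auto
    ultimately show ?thesis unfolding arcs_ends_conv by (metis (no_types, lifting) imageI)
  qed
  have "inj_on (iso_verts h) (verts \<Gamma>)"
    using h by (rule pre_digraph.digraph_isomorphism_inj_on_verts)
  moreover have "iso_verts h ` verts \<Gamma> \<subseteq> verts \<Delta>"
    using subgraph_imp_subverts[OF sub] by simp
  ultimately have "adjacency_embedding (iso_verts h) \<Gamma> \<Delta>"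
    using adj unfolding adjacency_embedding_def by blast
  then show "\<exists>f. adjacency_embedding f \<Gamma> \<Delta>" by blast
next
  assume "\<exists>f. adjacency_embedding f \<Gamma> \<Delta>"
  then obtain f where f: "adjacency_embedding f \<Gamma> \<Delta>" ..
  interpret \<Gamma>: graph \<Gamma> by fact
  interpret \<Delta>: graph \<Delta> by fact
  have "\<forall>e\<in>arcs \<Gamma>. \<exists>e'. e' \<in> arcs \<Delta> \<and> tail \<Delta> e' = f (tail \<Gamma> e) \<and> head \<Delta> e' = f (head \<Gamma> e)"
  proof
    fix e assume e: "e \<in> arcs \<Gamma>"
    then have "tail \<Gamma> e \<rightarrow>\<^bsub>\<Gamma>\<^esub> head \<Gamma> e" unfolding arcs_ends_conv by blast
    then have "f (tail \<Gamma> e) \<rightarrow>\<^bsub>\<Delta>\<^esub> f (head \<Gamma> e)"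
      using f e \<Gamma>.wellformed unfolding adjacency_embedding_def by blast
    then show "\<exists>e'. e' \<in> arcs \<Delta> \<and> tail \<Delta> e' = f (tail \<Gamma> e) \<and> head \<Delta> e' = f (head \<Gamma> e)"
      unfolding arcs_ends_conv by (elim imageE) auto
  qed
  from bchoice[OF this] obtain g where g: "\<And>e. e \<in> arcs \<Gamma> \<Longrightarrow>
      g e \<in> arcs \<Delta> \<and> tail \<Delta> (g e) = f (tail \<Gamma> e) \<and> head \<Delta> (g e) = f (head \<Gamma> e)"
    by blast
  have inj_f: "inj_on f (verts \<Gamma>)" and f_verts: "f ` verts \<Gamma> \<subseteq> verts \<Delta>"
    using f by (auto simp: adjacency_embedding_def)
  have inj_g: "inj_on g (arcs \<Gamma>)"
  proof (rule inj_onI)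
    fix e e' assume e: "e \<in> arcs \<Gamma>" "e' \<in> arcs \<Gamma>" "g e = g e'"
    then have "f (tail \<Gamma> e) = f (tail \<Gamma> e')" "f (head \<Gamma> e) = f (head \<Gamma> e')"
      using g by metis+
    then have "arc_to_ends \<Gamma> e = arc_to_ends \<Gamma> e'"
      using inj_f e by (auto simp: arc_to_ends_def dest: inj_onD)
    then show "e = e'" using e \<Gamma>.no_multi_arcs by blast
  qed
  define h where "h = \<lparr>iso_verts = f, iso_arcs = g, iso_head = head \<Delta>, iso_tail = tail \<Delta>\<rparr>"
  have h: "\<Gamma>.digraph_isomorphism h"
    using inj_f inj_g g \<Gamma>.wf_digraph by (simp add: \<Gamma>.digraph_isomorphism_def h_def)
  have "subgraph (app_iso h \<Gamma>) \<Delta>"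
    unfolding subgraph_def
  proof (intro conjI)
    show "wf_digraph (app_iso h \<Gamma>)" using h by (rule \<Gamma>.wf_digraphI_app_iso)
    show "wf_digraph \<Delta>" by (rule \<Delta>.wf_digraph)
  qed (use f_verts g in \<open>auto simp: h_def app_iso_def compatible_def\<close>)
  moreover have "digraph_iso \<Gamma> (app_iso h \<Gamma>)" using h by (auto simp: digraph_iso_def)
  ultimately show "graph_le \<Gamma> \<Delta>" unfolding graph_le_def by blast
qed

lemma threshold_graph_iso:
  assumes iso: "digraph_iso \<Gamma> \<Delta>" and \<Gamma>: "threshold_graph \<Gamma> w t" and \<Delta>: "graph \<Delta>"
  shows "\<exists>w'. threshold_graph \<Delta> w' t"
proof -
  obtain h where h: "pre_digraph.digraph_isomorphism \<Gamma> h" and \<Delta>_eq: "\<Delta> = app_iso h \<Gamma>"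
    using iso by (auto simp: digraph_iso_def)
  interpret \<Gamma>: graph \<Gamma> using \<Gamma> by (simp add: threshold_graph_def)
  let ?f = "iso_verts h"
  have inj: "inj_on ?f (verts \<Gamma>)" using h by (rule \<Gamma>.digraph_isomorphism_inj_on_verts)
  define w' where "w' x = w (the_inv_into (verts \<Gamma>) ?f x)" for x
  have w': "w' (?f u) = w u" if "u \<in> verts \<Gamma>" for u
    using that inj by (simp add: w'_def the_inv_into_f_f)
  have adj: "?f u \<rightarrow>\<^bsub>\<Delta>\<^esub> ?f v \<longleftrightarrow> u \<rightarrow>\<^bsub>\<Gamma>\<^esub> v" if uv: "u \<in> verts \<Gamma>" "v \<in> verts \<Gamma>" for u v
  proof
    assume "?f u \<rightarrow>\<^bsub>\<Delta>\<^esub> ?f v"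
    then obtain u' v' where "u' \<rightarrow>\<^bsub>\<Gamma>\<^esub> v'" "?f u' = ?f u" "?f v' = ?f v"
      unfolding \<Delta>_eq \<Gamma>.arcs_ends_app_iso_eq[OF h] by auto
    moreover from this have "u' \<in> verts \<Gamma>" "v' \<in> verts \<Gamma>" by (auto simp: arcs_ends_conv)
    ultimately show "u \<rightarrow>\<^bsub>\<Gamma>\<^esub> v" using uv inj by (metis inj_onD)
  next
    assume "u \<rightarrow>\<^bsub>\<Gamma>\<^esub> v"
    then show "?f u \<rightarrow>\<^bsub>\<Delta>\<^esub> ?f v" unfolding \<Delta>_eq \<Gamma>.arcs_ends_app_iso_eq[OF h] by force
  qed
  have "threshold_graph \<Delta> w' t"
    unfolding threshold_graph_def
  proof (intro conjI ballI)
    fix x y assume "x \<in> verts \<Delta>" "y \<in> verts \<Delta>"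
    then obtain u v where uv: "u \<in> verts \<Gamma>" "v \<in> verts \<Gamma>" "x = ?f u" "y = ?f v"
      by (auto simp: \<Delta>_eq)
    have "?f u \<noteq> ?f v \<longleftrightarrow> u \<noteq> v" using uv inj by (auto dest: inj_onD)
    then show "x \<rightarrow>\<^bsub>\<Delta>\<^esub> y \<longleftrightarrow> x \<noteq> y \<and> t \<le> w' x + w' y"
      using uv \<Gamma> adj[of u v] by (simp add: w' threshold_graph_def)
  qed (rule \<Delta>)
  then show ?thesis by blast
qed

lemma no_isolated_iso:
  assumes iso: "digraph_iso \<Gamma> \<Delta>" and "wf_digraph \<Gamma>"
    and pos: "\<And>v. v \<in> verts \<Gamma> \<Longrightarrow> 0 < out_degree \<Gamma> v" and v: "v \<in> verts \<Delta>"
  shows "0 < out_degree \<Delta> v"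
proof -
  interpret wf_digraph \<Gamma> by fact
  obtain h where h: "digraph_isomorphism h" and \<Delta>_eq: "\<Delta> = app_iso h \<Gamma>"
    using iso by (auto simp: digraph_iso_def)
  obtain u where "u \<in> verts \<Gamma>" "v = iso_verts h u" using v by (auto simp: \<Delta>_eq)
  then show ?thesis using pos by (simp add: \<Delta>_eq out_degree_app_iso_eq[OF h])
qed

section \<open>Group-annihilator graphs of cyclic groups\<close>

text \<open>
  In \<open>\<Z>/n\<Z>\<close> the element \<open>a\<close> generates the same subgroup as \<open>gcd(a, n)\<close>, and this subgroup contains
  all multiples of \<open>x\<close> as soon as it contains \<open>x\<close>.
\<close>

lemma residual_integer_mod_group:
  assumes "1 < n"
  shows "residual (integer_mod_group n) a = {x. gcd a (int n) dvd x}"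
proof (intro equalityI subsetI)
  fix x assume "x \<in> residual (integer_mod_group n) a"
  moreover have "1 \<in> carrier (integer_mod_group n)" using assms by simp
  ultimately have "1 [^]\<^bsub>integer_mod_group n\<^esub> x \<in>
      range (\<lambda>z::int. a [^]\<^bsub>integer_mod_group n\<^esub> z)"
    by (auto simp: residual_def)
  then obtain z where "x mod int n = (z * a) mod int n"
    by (auto simp: int_pow_integer_mod_group)
  then have "int n dvd x - z * a" by (simp add: mod_eq_dvd_iff)
  then have "gcd a (int n) dvd x - z * a" by (rule dvd_trans[OF gcd_dvd2])
  then have "gcd a (int n) dvd x - z * a + z * a" by (rule dvd_add) simp
  then show "x \<in> {x. gcd a (int n) dvd x}" by simp
next
  fix x assume "x \<in> {x. gcd a (int n) dvd x}"
  then obtain k where k: "x = gcd a (int n) * k" by (auto elim: dvdE)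
  obtain u v where uv: "u * a + v * int n = gcd a (int n)" using bezout_int by blast
  have "(x * g) mod int n = ((k * u * g) * a) mod int n" for g
  proof -
    have "x * g - (k * u * g) * a = int n * (k * v * g)"
      unfolding k uv[symmetric] by (simp add: algebra_simps)
    then show ?thesis by (simp add: mod_eq_dvd_iff)
  qed
  then have "g [^]\<^bsub>integer_mod_group n\<^esub> x \<in>
      range (\<lambda>z::int. a [^]\<^bsub>integer_mod_group n\<^esub> z)" for g
    unfolding int_pow_integer_mod_group by blast
  then show "x \<in> residual (integer_mod_group n) a" by (auto simp: residual_def)
qed

text \<open>
  The generator 1 of \<open>\<Z>/n\<Z>\<close> has order \<open>n\<close>, so only multiples of \<open>n\<close> annihilate the whole group.
\<close>

lemma ideal_action_integer_mod_group_trivial_iff: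
  assumes "1 < n"
  shows "ideal_action (integer_mod_group n) I = {\<one>\<^bsub>integer_mod_group n\<^esub>} \<longleftrightarrow> (\<forall>x\<in>I. int n dvd x)"
proof -
  interpret Z: group "integer_mod_group n" by simp
  let ?S = "{g [^]\<^bsub>integer_mod_group n\<^esub> x | g x. g \<in> carrier (integer_mod_group n) \<and> x \<in> I}"
  have "generate (integer_mod_group n) ?S = {0} \<longleftrightarrow> ?S \<subseteq> {0}"
  proof
    assume "generate (integer_mod_group n) ?S = {0}"
    then show "?S \<subseteq> {0}" using generate.incl[of _ ?S "integer_mod_group n"] by blast
  next
    assume "?S \<subseteq> {0}"
    then have "generate (integer_mod_group n) ?S \<subseteq> generate (integer_mod_group n) {0}"
      by (rule Z.mono_generate)
    also have "\<dots> = {0}" using Z.generate_one by simp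
    finally show "generate (integer_mod_group n) ?S = {0}"
      using generate.one[of "integer_mod_group n" ?S] by auto
  qed
  also have "?S \<subseteq> {0} \<longleftrightarrow> (\<forall>x\<in>I. int n dvd x)"
  proof
    assume S: "?S \<subseteq> {0}"
    show "\<forall>x\<in>I. int n dvd x"
    proof
      fix x assume "x \<in> I"
      moreover have "1 \<in> carrier (integer_mod_group n)" using assms by simp
      ultimately have "1 [^]\<^bsub>integer_mod_group n\<^esub> x \<in> ?S" by blast
      then have "1 [^]\<^bsub>integer_mod_group n\<^esub> x = 0" using S by blast
      then show "int n dvd x" by (simp add: int_pow_integer_mod_group mod_0_imp_dvd)
    qed
  next
    assume I: "\<forall>x\<in>I. int n dvd x"
    have "g [^]\<^bsub>integer_mod_group n\<^esub> x = 0" if "x \<in> I" for g x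
      unfolding int_pow_integer_mod_group using I that by (simp add: dvd_imp_mod_0)
    then show "?S \<subseteq> {0}" by blast
  qed
  finally show ?thesis by (simp add: ideal_action_def)
qed

lemma ideal_prod_multiples_subset_iff:
  "(\<forall>x\<in>ideal_prod \<Z> {x. d dvd x} {x. e dvd x}. c dvd x) \<longleftrightarrow> c dvd d * e"
proof
  assume "\<forall>x\<in>ideal_prod \<Z> {x. d dvd x} {x. e dvd x}. c dvd x"
  moreover have "d * e \<in> ideal_prod \<Z> {x. d dvd x} {x. e dvd x}"
    using ideal_prod.prod[of d "{x. d dvd x}" e "{x. e dvd x}" \<Z>] by simp
  ultimately show "c dvd d * e" by blast
next
  assume c: "c dvd d * e"
  show "\<forall>x\<in>ideal_prod \<Z> {x. d dvd x} {x. e dvd x}. c dvd x"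
  proof
    fix x assume "x \<in> ideal_prod \<Z> {x. d dvd x} {x. e dvd x}"
    then show "c dvd x"
    proof induction
      case (prod i j)
      then have "d * e dvd i * j" by (intro mult_dvd_mono) auto
      then show ?case using dvd_trans[OF c] by simp
    next
      case (sum s1 s2)
      then show ?case by simp
    qed
  qed
qed

lemma graph_ann_graph_integer_mod_group:
  "1 < n \<Longrightarrow> graph (ann_graph (integer_mod_group n))"
  by (rule graph_ann_graph) (simp add: carrier_integer_mod_group)

lemma ann_graph_integer_mod_group_adjacent_iff:
  assumes "1 < n" "a \<in> carrier (integer_mod_group n)" "b \<in> carrier (integer_mod_group n)"
  shows "a \<rightarrow>\<^bsub>ann_graph (integer_mod_group n)\<^esub> b \<longleftrightarrow>
    a \<noteq> b \<and> int n dvd gcd a (int n) * gcd b (int n)"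
proof -
  let ?Z = "integer_mod_group n"
  have "a \<rightarrow>\<^bsub>ann_graph ?Z\<^esub> b \<longleftrightarrow>
      a \<noteq> b \<and> ideal_action ?Z (ideal_prod \<Z> (residual ?Z a) (residual ?Z b)) = {\<one>\<^bsub>?Z\<^esub>}"
    unfolding ann_graph_def with_proj_simps pair_pre_digraph.simps using assms(2,3) by blast
  then show ?thesis
    unfolding residual_integer_mod_group[OF assms(1)]
      ideal_action_integer_mod_group_trivial_iff[OF assms(1)] ideal_prod_multiples_subset_iff .
qed

text \<open>
  With \<open>gcd(a, q\<^sup>m) = q\<^bsup>k(a)\<^esup>\<close> the adjacency criterion becomes \<open>k(a) + k(b) \<ge> m\<close>.
\<close>

lemma threshold_ann_graph_prime_power:
  assumes "prime q" "1 \<le> m"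
  shows "\<exists>w t. threshold_graph (ann_graph (integer_mod_group (q ^ m))) w t"
proof -
  let ?Z = "integer_mod_group (q ^ m)"
  have q: "1 < q ^ m" using assms(2) prime_gt_1_nat[OF assms(1)] by (intro one_less_power) simp_all
  have "\<forall>a. \<exists>k. gcd a (int (q ^ m)) = int q ^ k"
  proof
    fix a
    obtain k where "gcd (nat \<bar>a\<bar>) (q ^ m) = q ^ k"
      using divides_primepow_nat[OF assms(1), THEN iffD1, OF gcd_dvd2] by blast
    moreover have "gcd a (int (q ^ m)) = int (gcd (nat \<bar>a\<bar>) (q ^ m))"
      unfolding gcd_int_def by (simp only: abs_of_nat nat_int)
    ultimately have "gcd a (int (q ^ m)) = int q ^ k" by (simp only: of_nat_power)
    then show "\<exists>k. gcd a (int (q ^ m)) = int q ^ k" by blast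
  qed
  from choice[OF this] obtain k where k: "\<And>a. gcd a (int (q ^ m)) = int q ^ k a" by blast
  have dvd: "int (q ^ m) dvd gcd a (int (q ^ m)) * gcd b (int (q ^ m)) \<longleftrightarrow> m \<le> k a + k b" for a b
    unfolding k unfolding of_nat_power power_add[symmetric]
    using prime_gt_1_nat[OF assms(1)] by (subst dvd_power_iff) auto
  have "threshold_graph (ann_graph ?Z) (\<lambda>a. int (k a)) (int m)"
    unfolding threshold_graph_def
  proof (intro conjI ballI)
    show "graph (ann_graph ?Z)" using q by (rule graph_ann_graph_integer_mod_group)
    fix a b assume "a \<in> verts (ann_graph ?Z)" "b \<in> verts (ann_graph ?Z)"
    then have ab: "a \<in> carrier ?Z" "b \<in> carrier ?Z" by (simp_all add: ann_graph_def)
    show "a \<rightarrow>\<^bsub>ann_graph ?Z\<^esub> b \<longleftrightarrow> a \<noteq> b \<and> int m \<le> int (k a) + int (k b)"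
      unfolding ann_graph_integer_mod_group_adjacent_iff[OF q ab] dvd by linarith
  qed
  then show ?thesis by blast
qed

text \<open>
  The element 0 is joined to every other element, and there is one since \<open>n > 1\<close>.
\<close>

lemma ann_graph_integer_mod_group_no_isolated:
  assumes n: "1 < n" and v: "v \<in> verts (ann_graph (integer_mod_group n))"
  shows "0 < out_degree (ann_graph (integer_mod_group n)) v"
proof -
  let ?G = "ann_graph (integer_mod_group n)"
  interpret graph ?G using n by (rule graph_ann_graph_integer_mod_group)
  have verts: "verts ?G = carrier (integer_mod_group n)" by (simp add: ann_graph_def)
  define u :: int where "u = (if v = 0 then 1 else 0)"
  have u: "u \<in> verts ?G" using n by (simp add: u_def verts)
  moreover have "v \<rightarrow>\<^bsub>?G\<^esub> u"
    using n u v unfolding verts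
    by (subst ann_graph_integer_mod_group_adjacent_iff) (auto simp: u_def)
  ultimately have "{u. u \<in> verts ?G \<and> v \<rightarrow>\<^bsub>?G\<^esub> u} \<noteq> {}" by blast
  then show ?thesis
    unfolding out_degree_eq_card_neighbours by (simp add: card_gt_0_iff)
qed

lemma realized_graphs_threshold:
  assumes "\<forall>r\<in>{1..n}. prime (p r)" and "graph \<Gamma>" and "\<Gamma> \<in> realized_graphs p n"
  shows "\<exists>w t. threshold_graph \<Gamma> w t" and "verts \<Gamma> \<noteq> {}"
    and "\<And>v. v \<in> verts \<Gamma> \<Longrightarrow> 0 < out_degree \<Gamma> v"
proof -
  obtain r m where r: "r \<in> {1..n}" and m: "1 \<le> m"
    and iso: "digraph_iso (ann_graph (integer_mod_group (p r ^ m))) \<Gamma>"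
    using assms(3) by (auto simp: realized_graphs_def)
  let ?\<Gamma> = "ann_graph (integer_mod_group (p r ^ m))"
  have pr: "prime (p r)" using assms(1) r by blast
  have card: "1 < p r ^ m" using m prime_gt_1_nat[OF pr] by (intro one_less_power) simp_all
  show "\<exists>w t. threshold_graph \<Gamma> w t"
    using threshold_ann_graph_prime_power[OF pr m] threshold_graph_iso[OF iso _ assms(2)] by blast
  have "0 \<in> verts ?\<Gamma>" by (simp add: ann_graph_def)
  then show "verts \<Gamma> \<noteq> {}" using iso by (auto simp: digraph_iso_def)
  have "graph ?\<Gamma>" using card by (rule graph_ann_graph_integer_mod_group)
  then have "wf_digraph ?\<Gamma>" by (simp add: graph_def digraph_def fin_digraph_def)
  then show "0 < out_degree \<Gamma> v" if "v \<in> verts \<Gamma>" for v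
    using no_isolated_iso[OF iso] ann_graph_integer_mod_group_no_isolated[OF card] that by blast
qed

section \<open>Subgraphs and Young diagrams of eigenvalues\<close>

theorem theorem13:
  fixes p :: "nat \<Rightarrow> nat" and n :: nat
    and G :: "('a, 'c) monoid_scheme" and H :: "('b, 'd) monoid_scheme"
  assumes "\<forall>r\<in>{1..n}. prime (p r)"
    and "strict_mono_on {1..n} p"
    and "comm_group G" and "finite (carrier G)"
    and "comm_group H" and "finite (carrier H)"
    and "ann_graph G \<in> realized_graphs p n"
    and "ann_graph H \<in> realized_graphs p n"
  shows "graph_le (ann_graph G) (ann_graph H) \<longleftrightarrow>
    fits_in (young_diagram (eigenvalues_partition (ann_graph G)))
            (young_diagram (eigenvalues_partition (ann_graph H)))"
proof -
  have graphs: "graph (ann_graph G)" "graph (ann_graph H)"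
    using assms(4,6) by (auto intro: graph_ann_graph)
  note G = realized_graphs_threshold[OF assms(1) graphs(1) assms(7)]
  note H = realized_graphs_threshold[OF assms(1) graphs(2) assms(8)]
  obtain w t where w: "threshold_graph (ann_graph G) w t" using G(1) by blast
  obtain w' t' where w': "threshold_graph (ann_graph H) w' t'" using H(1) by blast
  show ?thesis
    unfolding graph_le_iff_adjacency_embedding[OF graphs]
    by (rule threshold_embedding_iff_young_diagram[OF w w' G(2) H(2) G(3)])
qed

end
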